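(* Let $X$ be a reflexive Banach space, let $F\subseteq X$ be a closed convex set with $0\in F$, and let $Q\subseteq X$ be a nonempty closed bounded convex set. Suppose $\bar x\notin Q-F_\infty$ and $\mathcal{T}^F_Q(\bar x)<\infty$. Then $$\partial\mathcal{T}^F_Q(\bar x)=[-\partial\rho_F(\bar\omega-\bar x)]\cap N(\bar\omega;Q)$$ for any $\bar\omega\in\Pi_F(\bar x;Q)$, where $$\Pi_F(\bar x;Q)=\{\omega\in Q: \mathcal{T}^F_Q(\bar x)=\rho_F(\omega-\bar x)\}.$$
   Context: Normed spaces are real; $X^*$ is the dual of $X$ and $\langle x^*,x\rangle=x^*(x)$. For $t\ge 0$, $tF=\{tf: f\in F\}$ (so $0F=\{0\}$), and $\inf\emptyset=\infty$. The minimal time function is $\mathcal{T}^F_Q(x)=\inf\{t\ge 0: (x+tF)\cap Q\ne\emptyset\}\in[0,\infty]$, and the Minkowski function is $\rho_F(x)=\inf\{t\ge 0: x\in tF\}\in[0,\infty]$. The asymptotic cone of $F$ is $F_\infty=\{d\in X: x+td\in F \text{ for all } t>0\}$, where $x\in F$ is any point (the set does not depend on the choice of $x\in F$). For a convex $\varphi:X\to(-\infty,\infty]$ and $\bar x$ with $\varphi(\bar x)<\infty$, $\partial\varphi(\bar x)=\{x^*\in X^*: \langle x^*,x-\bar x\rangle\le\varphi(x)-\varphi(\bar x)\text{ for all }x\in X\}$. For a convex set $A$ and $\bar x\in A$, $N(\bar x;A)=\{x^*\in X^*: \langle x^*,x-\bar x\rangle\le 0\text{ for all }x\in A\}$. 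*)

theory Defs
  imports "HOL-Analysis.Analysis"
begin

text \<open>The dual of \<open>X\<close> is \<^typ>\<open>'a \<Rightarrow>\<^sub>L real\<close>; reflexivity is surjectivity of the
  canonical embedding into the bidual.\<close>

definition reflexive_space :: "'a::real_normed_vector itself \<Rightarrow> bool" where
  "reflexive_space _ \<longleftrightarrow>
     (\<forall>\<Phi> :: ('a \<Rightarrow>\<^sub>L real) \<Rightarrow>\<^sub>L real. \<exists>x::'a. \<forall>f. blinfun_apply \<Phi> f = blinfun_apply f x)"

definition minimal_time :: "'a::real_normed_vector set \<Rightarrow> 'a set \<Rightarrow> 'a \<Rightarrow> ereal" where
  "minimal_time F Q x =
     Inf {ereal t |t. 0 \<le> t \<and> (\<lambda>z. x + z) ` ((\<lambda>f. t *\<^sub>R f) ` F) \<inter> Q \<noteq> {}}"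

definition minkowski_fun :: "'a::real_normed_vector set \<Rightarrow> 'a \<Rightarrow> ereal" where
  "minkowski_fun F x = Inf {ereal t |t. 0 \<le> t \<and> x \<in> (\<lambda>f. t *\<^sub>R f) ` F}"

text \<open>Quantifying over every base point makes the definition choice-free; for nonempty closed
  convex \<open>F\<close> a single, arbitrary base point gives the same set, see
  \<open>asymptotic_cone_base_point\<close>.\<close>

definition asymptotic_cone :: "'a::real_normed_vector set \<Rightarrow> 'a set" where
  "asymptotic_cone F = {d. \<forall>x\<in>F. \<forall>t>0. x + t *\<^sub>R d \<in> F}"

lemma asymptotic_cone_base_point:
  fixes F :: "'a::real_normed_vector set"
  assumes "closed F" "convex F" "x \<in> F"
  shows "asymptotic_cone F = {d. \<forall>t>0. x + t *\<^sub>R d \<in> F}"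
proof -
  have "y + t *\<^sub>R d \<in> F" if d: "\<forall>t>0. x + t *\<^sub>R d \<in> F" and y: "y \<in> F" and t: "0 < t" for d y t
  proof -
    define s where "s = (\<lambda>n. y + t *\<^sub>R d + inverse (real (Suc n)) *\<^sub>R (x - y))"
    have "s n \<in> F" for n
    proof -
      let ?u = "inverse (real (Suc n))"
      have "x + (real (Suc n) * t) *\<^sub>R d \<in> F"
        using d t by simp
      then have "(1 - ?u) *\<^sub>R y + ?u *\<^sub>R (x + (real (Suc n) * t) *\<^sub>R d) \<in> F"
        using assms(2) y by (intro convexD) (auto simp: field_simps)
      also have "(1 - ?u) *\<^sub>R y + ?u *\<^sub>R (x + (real (Suc n) * t) *\<^sub>R d) = s n"
        unfolding s_def by (simp add: algebra_simps del: of_nat_Suc)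
      finally show ?thesis .
    qed
    moreover have "s \<longlonglongrightarrow> y + t *\<^sub>R d + 0 *\<^sub>R (x - y)"
      unfolding s_def by (intro tendsto_intros LIMSEQ_inverse_real_of_nat)
    ultimately show ?thesis
      using closed_sequentially[OF assms(1), of s] by simp
  qed
  then show ?thesis
    using assms(3) unfolding asymptotic_cone_def by blast
qed

text \<open>Meaningful only where \<open>\<phi> xb\<close> is finite, so that the \<^typ>\<open>ereal\<close> difference is the
  usual one.\<close>

definition subdifferential ::
  "('a::real_normed_vector \<Rightarrow> ereal) \<Rightarrow> 'a \<Rightarrow> ('a \<Rightarrow>\<^sub>L real) set" where
  "subdifferential \<phi> xb = {v. \<forall>x. ereal (blinfun_apply v (x - xb)) \<le> \<phi> x - \<phi> xb}"

definition normal_cone :: "'a::real_normed_vector \<Rightarrow> 'a set \<Rightarrow> ('a \<Rightarrow>\<^sub>L real) set" where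
  "normal_cone xb A = {v. \<forall>x\<in>A. blinfun_apply v (x - xb) \<le> 0}"

definition gen_projection :: "'a::real_normed_vector set \<Rightarrow> 'a \<Rightarrow> 'a set \<Rightarrow> 'a set" where
  "gen_projection F x Q = {w \<in> Q. minimal_time F Q x = minkowski_fun F (w - x)}"

end

theory Submission
  imports Defs
begin

text \<open>The minimal time function is the infimal convolution
  \<open>T(x) = inf {\<rho>(q - x) | q \<in> Q}\<close>. Given a subgradient of \<open>T\<close> at \<open>xb\<close>, testing it at \<open>w - y\<close>
  yields the subgradient inequality for \<open>\<rho>\<close> at \<open>w - xb\<close>, and testing it at \<open>q - (w - xb)\<close> yields
  normality to \<open>Q\<close> at \<open>w\<close>. Conversely, the subgradient inequality for \<open>\<rho>\<close> at \<open>q - x\<close>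
  combined with normality bounds every \<open>\<rho>(q - x)\<close> from below, hence also the infimum.\<close>

text \<open>Since \<open>x + t *\<^sub>R f = q\<close> means \<open>q - x = t *\<^sub>R f\<close>,
  the admissible times are the union over \<open>q\<close> of those for
  \<open>q - x\<close>.\<close>

lemma minimal_time_eq_INF:
  "minimal_time F Q x = (INF q\<in>Q. minkowski_fun F (q - x))"
proof -
  have "(\<lambda>z. x + z) ` ((\<lambda>f. t *\<^sub>R f) ` F) \<inter> Q \<noteq> {} \<longleftrightarrow> (\<exists>q\<in>Q. q - x \<in> (\<lambda>f. t *\<^sub>R f) ` F)" for t
    by (force simp: image_iff algebra_simps)
  then have "{ereal t |t. 0 \<le> t \<and> (\<lambda>z. x + z) ` ((\<lambda>f. t *\<^sub>R f) ` F) \<inter> Q \<noteq> {}}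
      = (\<Union>q\<in>Q. {ereal t |t. 0 \<le> t \<and> q - x \<in> (\<lambda>f. t *\<^sub>R f) ` F})"
    by auto
  then show ?thesis
    unfolding minimal_time_def minkowski_fun_def
    by (auto intro!: antisym Inf_greatest INF_greatest intro: Inf_lower INF_lower2)
qed

lemma minimal_time_le_minkowski:
  "q \<in> Q \<Longrightarrow> minimal_time F Q x \<le> minkowski_fun F (q - x)"
  unfolding minimal_time_eq_INF by (rule INF_lower)

lemma minimal_time_nonneg: "0 \<le> minimal_time F Q x"
  unfolding minimal_time_def by (auto intro!: Inf_greatest)

lemma subdifferential_finite_iff:
  assumes "\<phi> xb = ereal r"
  shows "v \<in> subdifferential \<phi> xb \<longleftrightarrow> (\<forall>x. ereal (blinfun_apply v (x - xb) + r) \<le> \<phi> x)"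
  using assms by (simp add: subdifferential_def ereal_le_minus)

lemma subdifferential_minimal_time:
  fixes F Q :: "'a::real_normed_vector set"
  assumes fin: "minimal_time F Q xb < \<infinity>" and w: "w \<in> gen_projection F xb Q"
  shows "subdifferential (minimal_time F Q) xb
      = uminus ` subdifferential (minkowski_fun F) (w - xb) \<inter> normal_cone w Q"
proof -
  \<comment> \<open>Membership of \<open>w\<close> in the projection gives both functions the same
    real value \<open>r\<close> at their base points, so \<open>r\<close> cancels between the two
    subgradient inequalities.\<close>
  obtain r where T: "minimal_time F Q xb = ereal r"
    using fin minimal_time_nonneg[of F Q xb] by (cases "minimal_time F Q xb") auto
  have wQ: "w \<in> Q" and rho: "minkowski_fun F (w - xb) = ereal r"
    using w T by (auto simp: gen_projection_def)
  note T_iff = subdifferential_finite_iff[of "minimal_time F Q", OF T]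
  note rho_iff = subdifferential_finite_iff[of "minkowski_fun F", OF rho]
  have "v \<in> subdifferential (minimal_time F Q) xb \<longleftrightarrow>
      - v \<in> subdifferential (minkowski_fun F) (w - xb) \<and> v \<in> normal_cone w Q" for v
  proof (intro iffI conjI)
    assume "v \<in> subdifferential (minimal_time F Q) xb"
    then have sub: "ereal (blinfun_apply v (x - xb) + r) \<le> minimal_time F Q x" for x
      by (simp add: T_iff)
    show "- v \<in> subdifferential (minkowski_fun F) (w - xb)"
      unfolding rho_iff
    proof
      fix y
      \<comment> \<open>The point \<open>w - y\<close> reaches \<open>w\<close> by the displacement
        \<open>y\<close>.\<close>
      have "blinfun_apply (- v) (y - (w - xb)) = blinfun_apply v (w - y - xb)"
        by (simp add: blinfun.bilinear_simps)
      then show "ereal (blinfun_apply (- v) (y - (w - xb)) + r) \<le> minkowski_fun F y"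
        using order_trans[OF sub[of "w - y"] minimal_time_le_minkowski[OF wQ]] by simp
    qed
    show "v \<in> normal_cone w Q"
      unfolding normal_cone_def
    proof (clarify)
      fix q assume "q \<in> Q"
      \<comment> \<open>The displacement from \<open>q - (w - xb)\<close> to \<open>q\<close> is
        \<open>w - xb\<close>, of cost \<open>r\<close>.\<close>
      from order_trans[OF sub[of "q - (w - xb)"] minimal_time_le_minkowski[OF this]]
      show "blinfun_apply v (q - w) \<le> 0"
        by (simp add: rho)
    qed
  next
    assume v: "- v \<in> subdifferential (minkowski_fun F) (w - xb) \<and> v \<in> normal_cone w Q"
    show "v \<in> subdifferential (minimal_time F Q) xb"
      unfolding T_iff minimal_time_eq_INF
    proof (intro allI INF_greatest)
      fix x q assume "q \<in> Q"
      with v have "blinfun_apply v (q - w) \<le> 0"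
        by (simp add: normal_cone_def)
      \<comment> \<open>The right side exceeds the left by exactly
        \<open>- blinfun_apply v (q - w)\<close>.\<close>
      then have "blinfun_apply v (x - xb) \<le> blinfun_apply (- v) (q - x - (w - xb))"
        by (simp add: blinfun.bilinear_simps)
      then have "ereal (blinfun_apply v (x - xb) + r)
          \<le> ereal (blinfun_apply (- v) (q - x - (w - xb)) + r)"
        by simp
      also have "\<dots> \<le> minkowski_fun F (q - x)"
        using v by (simp only: rho_iff)
      finally show "ereal (blinfun_apply v (x - xb) + r) \<le> minkowski_fun F (q - x)" .
    qed
  qed
  moreover have "v \<in> uminus ` A \<longleftrightarrow> - v \<in> A" for v :: "'a \<Rightarrow>\<^sub>L real" and A
    by (force simp: image_iff)
  ultimately show ?thesis
    by blast
qed

theorem theorem4p4: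
  fixes F Q :: "'a::banach set" and xb :: 'a
  assumes "reflexive_space TYPE('a)"
    and "closed F" and "convex F" and "0 \<in> F"
    and "Q \<noteq> {}" and "closed Q" and "bounded Q" and "convex Q"
    and "xb \<notin> {q - d |q d. q \<in> Q \<and> d \<in> asymptotic_cone F}"
    and "minimal_time F Q xb < \<infinity>"
  shows "\<forall>wb \<in> gen_projection F xb Q.
    subdifferential (minimal_time F Q) xb
      = uminus ` subdifferential (minkowski_fun F) (wb - xb) \<inter> normal_cone wb Q"
  using subdifferential_minimal_time[OF assms(10)] by blast

end
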